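(* If a metric space $M$ admits an isometric embedding into a Banach space $X$, then there exists a set $\mathcal{K}$ of real-valued functions on $M$ satisfying conditions (A) and (B) such that $\mathrm{TP}_{\mathcal{K}}(M)$ is linearly isometric to a subspace of $X$.
   Context: Banach spaces are over $\mathbb{R}$; an isometric embedding of a metric space into a Banach space is a distance-preserving, not necessarily linear, map. Let $(M,d)$ be a metric space. $\mathrm{TP}(M)$ is the real vector space of all finitely supported functions $f:M\to\mathbb{R}$ with $\sum_{v\in M}f(v)=0$. For a set $\mathcal{K}$ of real-valued functions on $M$, conditions (A) and (B) are: (A) every function in $\mathcal{K}$ is $1$-Lipschitz; (B) for every $u,v\in M$ there is $l\in\mathcal{K}$ with $|l(u)-l(v)|=d(u,v)$. For such $\mathcal{K}$, define the seminorm $\|f\|_{\mathcal{K}}=\sup_{l\in\mathcal{K}}|l(f)|$ on $\mathrm{TP}(M)$, where $l(f)=\sum_{v\in M}l(v)f(v)$. If $\|\cdot\|_{\mathcal{K}}$ is a norm, $\mathrm{TP}_{\mathcal{K}}(M)$ is the completion of $(\mathrm{TP}(M),\|\cdot\|_{\mathcal{K}})$; in general, $\mathrm{TP}_{\mathcal{K}}(M)$ is the completion of the quotient of $\mathrm{TP}(M)$ by $\ker\|\cdot\|_{\mathcal{K}}$ with respect to the norm induced by $\|\cdot\|_{\mathcal{K}}$. (Equivalently, at the level of the seminormed space, the linear isometry is a linear map $E$ into $X$ with $\|Ef\|_X=\|f\|_{\mathcal{K}}$, which may have a kernel.) *)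

theory Defs
  imports "HOL-Analysis.Analysis"
begin

text \<open>
  Seminormed real vector spaces with an explicit carrier: the spaces below depend on a metric
  space and on a set of functions, so they cannot be types.
\<close>

record 'v seminormed_space =
  vecs :: "'v set"
  vadd :: "'v \<Rightarrow> 'v \<Rightarrow> 'v"
  vscale :: "real \<Rightarrow> 'v \<Rightarrow> 'v"
  vnorm :: "'v \<Rightarrow> real"

definition vdist :: "'v seminormed_space \<Rightarrow> 'v \<Rightarrow> 'v \<Rightarrow> real" where
  "vdist V x y = vnorm V (vadd V x (vscale V (- 1) y))"

definition null_rel :: "'v seminormed_space \<Rightarrow> ('v \<times> 'v) set" where
  "null_rel V = {(x, y). x \<in> vecs V \<and> y \<in> vecs V \<and> vdist V x y = 0}"

text \<open>
  The quotient by the kernel of the seminorm. The seminorm is constant on each class,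
  so the argument of \<open>the_elem\<close> is a singleton.
\<close>

definition kernel_quotient :: "'v seminormed_space \<Rightarrow> 'v set seminormed_space" where
  "kernel_quotient V =
    \<lparr> vecs = vecs V // null_rel V,
      vadd = (\<lambda>A B. \<Union>a\<in>A. \<Union>b\<in>B. null_rel V `` {vadd V a b}),
      vscale = (\<lambda>c A. \<Union>a\<in>A. null_rel V `` {vscale V c a}),
      vnorm = (\<lambda>A. the_elem (vnorm V ` A)) \<rparr>"

text \<open>
  The completion is the space of Cauchy sequences, with seminorm
  \<open>lim \<parallel>s n\<parallel>\<close>, modulo the sequences of seminorm zero, that is, modulo null sequences.
\<close>

definition cauchy_space :: "'v seminormed_space \<Rightarrow> (nat \<Rightarrow> 'v) seminormed_space" where
  "cauchy_space V =
    \<lparr> vecs = {s. (\<forall>n. s n \<in> vecs V) \<and>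
                 (\<forall>e>0. \<exists>N. \<forall>m\<ge>N. \<forall>n\<ge>N. vdist V (s m) (s n) < e)},
      vadd = (\<lambda>s t n. vadd V (s n) (t n)),
      vscale = (\<lambda>c s n. vscale V c (s n)),
      vnorm = (\<lambda>s. lim (\<lambda>n. vnorm V (s n))) \<rparr>"

definition completion :: "'v seminormed_space \<Rightarrow> (nat \<Rightarrow> 'v) set seminormed_space" where
  "completion V = kernel_quotient (cauchy_space V)"

definition linear_isometry_onto ::
    "'v seminormed_space \<Rightarrow> 'x::real_normed_vector set \<Rightarrow> ('v \<Rightarrow> 'x) \<Rightarrow> bool" where
  "linear_isometry_onto V S T \<longleftrightarrow>
     bij_betw T (vecs V) S \<and>
     (\<forall>x\<in>vecs V. \<forall>y\<in>vecs V. T (vadd V x y) = T x + T y) \<and>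
     (\<forall>c. \<forall>x\<in>vecs V. T (vscale V c x) = c *\<^sub>R T x) \<and>
     (\<forall>x\<in>vecs V. norm (T x) = vnorm V x)"

text \<open>Finitely supported functions on \<open>M\<close> are represented by their extensions by zero.\<close>

definition TP :: "'a set \<Rightarrow> ('a \<Rightarrow> real) set" where
  "TP M = {f. finite {v. f v \<noteq> 0} \<and> {v. f v \<noteq> 0} \<subseteq> M \<and> (\<Sum>v | f v \<noteq> 0. f v) = 0}"

definition pairing :: "('a \<Rightarrow> real) \<Rightarrow> ('a \<Rightarrow> real) \<Rightarrow> real" where
  "pairing l f = (\<Sum>v | f v \<noteq> 0. l v * f v)"

definition condition_A :: "'a set \<Rightarrow> ('a \<Rightarrow> 'a \<Rightarrow> real) \<Rightarrow> ('a \<Rightarrow> real) set \<Rightarrow> bool" where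
  "condition_A M d K \<longleftrightarrow> (\<forall>l\<in>K. \<forall>u\<in>M. \<forall>v\<in>M. \<bar>l u - l v\<bar> \<le> d u v)"

definition condition_B :: "'a set \<Rightarrow> ('a \<Rightarrow> 'a \<Rightarrow> real) \<Rightarrow> ('a \<Rightarrow> real) set \<Rightarrow> bool" where
  "condition_B M d K \<longleftrightarrow> (\<forall>u\<in>M. \<forall>v\<in>M. \<exists>l\<in>K. \<bar>l u - l v\<bar> = d u v)"

text \<open>
  The supremum is taken in \<open>[0, \<infinity>)\<close>; inserting \<open>0\<close> matters only for empty \<open>K\<close>, which
  condition (B) allows only if \<open>M\<close> is empty. Condition (A) makes the set bounded
  for every \<open>f\<close> in \<open>TP M\<close>.
\<close>

definition K_seminorm :: "('a \<Rightarrow> real) set \<Rightarrow> ('a \<Rightarrow> real) \<Rightarrow> real" where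
  "K_seminorm K f = Sup (insert 0 ((\<lambda>l. \<bar>pairing l f\<bar>) ` K))"

definition TP_seminormed ::
    "'a set \<Rightarrow> ('a \<Rightarrow> real) set \<Rightarrow> ('a \<Rightarrow> real) seminormed_space" where
  "TP_seminormed M K =
    \<lparr> vecs = TP M,
      vadd = (\<lambda>f g v. f v + g v),
      vscale = (\<lambda>c f v. c * f v),
      vnorm = K_seminorm K \<rparr>"

definition TP_completion ::
    "'a set \<Rightarrow> ('a \<Rightarrow> real) set \<Rightarrow> (nat \<Rightarrow> ('a \<Rightarrow> real) set) set seminormed_space" where
  "TP_completion M K = completion (kernel_quotient (TP_seminormed M K))"

end

theory Submission
  imports Defs
begin

text \<open>
  Let \<open>\<phi>\<close> be the embedding and let \<open>K\<close> consist of the functions \<open>g \<circ> \<phi>\<close> with \<open>g\<close> in the unit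
  ball of the dual of \<open>X\<close>. Every such function is \<open>1\<close>-Lipschitz, and norming functionals
  (Hahn-Banach) give (B). For the linear map \<open>E f = (\<Sum>v. f v \<phi>(v))\<close> one has \<open>l(f) = g(E f)\<close>
  when \<open>l = g \<circ> \<phi>\<close>, so that, again by Hahn-Banach, \<open>\<parallel>f\<parallel>\<^sub>K = \<parallel>E f\<parallel>\<close>. Since \<open>X\<close> is complete, \<open>E\<close>
  descends to the quotient and extends to the completion.
\<close>

section \<open>Norming functionals\<close>

text \<open>Homogeneity is asked only as an inequality for positive factors, which is the form
  easiest to check for infima; applying it to \<open>inverse c\<close> as well turns it into an
  equality.\<close>

definition sublinear :: "('x::real_vector \<Rightarrow> real) \<Rightarrow> bool" where
  "sublinear q \<longleftrightarrow> q 0 = 0 \<and> (\<forall>x y. q (x + y) \<le> q x + q y) \<and> (\<forall>c>0. \<forall>x. q (c *\<^sub>R x) \<le> c * q x)"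

lemma sublinearI:
  assumes "q 0 = 0" "\<And>x y. q (x + y) \<le> q x + q y" "\<And>c x. c > 0 \<Longrightarrow> q (c *\<^sub>R x) \<le> c * q x"
  shows "sublinear q"
  using assms by (simp add: sublinear_def)

lemma sublinear_0: "sublinear q \<Longrightarrow> q 0 = 0"
  and sublinear_add: "sublinear q \<Longrightarrow> q (x + y) \<le> q x + q y"
  by (auto simp: sublinear_def)

lemma sublinear_scaleR:
  assumes "sublinear q" "c \<ge> 0"
  shows "q (c *\<^sub>R x) = c * q x"
proof (cases "c = 0")
  case True
  with assms show ?thesis by (simp add: sublinear_0)
next
  case False
  with assms have c: "c > 0" by simp
  with assms have "q (inverse c *\<^sub>R (c *\<^sub>R x)) \<le> inverse c * q (c *\<^sub>R x)"
    unfolding sublinear_def by (metis positive_imp_inverse_positive)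
  with c have "c * q x \<le> q (c *\<^sub>R x)" by (simp add: field_simps)
  with assms c show ?thesis by (force simp: sublinear_def intro: antisym)
qed

text \<open>Turns an upper bound into a lower one: if \<open>q \<le> p\<close>, then
  \<open>- p (- x) \<le> q x\<close>. This keeps pointwise infima of chains finite.\<close>

lemma sublinear_minus: "sublinear q \<Longrightarrow> - q (- x) \<le> q x"
  using sublinear_add[of q x "- x"] sublinear_0[of q] by simp

text \<open>The standard device for lowering a sublinear functional: the result is still sublinear
  and lies below \<open>q\<close>, and taking \<open>t = 1\<close> shows that its value at
  \<open>- x\<close> is at most \<open>- q x\<close>.\<close>

definition directional_inf :: "('x::real_vector \<Rightarrow> real) \<Rightarrow> 'x \<Rightarrow> 'x \<Rightarrow> real" where
  "directional_inf q x y = (INF t\<in>{0..}. q (y + t *\<^sub>R x) - t * q x)"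

lemma directional_inf_le:
  assumes q: "sublinear q" and t: "t \<ge> 0"
  shows "directional_inf q x y \<le> q (y + t *\<^sub>R x) - t * q x"
proof -
  \<comment> \<open>The lower bound \<open>- q (- y)\<close> is independent of the parameter, so the
    real infimum is meaningful.\<close>
  have "- q (- y) \<le> q (y + s *\<^sub>R x) - s * q x" if "s \<ge> 0" for s
    using sublinear_add[OF q, of "y + s *\<^sub>R x" "- y"] sublinear_scaleR[OF q that, of x] by simp
  then have "bdd_below ((\<lambda>t. q (y + t *\<^sub>R x) - t * q x) ` {0..})"
    by (intro bdd_belowI2) auto
  then show ?thesis
    unfolding directional_inf_def using t by (intro cINF_lower) auto
qed

lemma directional_inf_greatest:
  assumes "\<And>t. t \<ge> 0 \<Longrightarrow> b \<le> q (y + t *\<^sub>R x) - t * q x"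
  shows "b \<le> directional_inf q x y"
  unfolding directional_inf_def using assms by (intro cINF_greatest) auto

lemma directional_inf_le_self: "sublinear q \<Longrightarrow> directional_inf q x y \<le> q y"
  using directional_inf_le[of q 0 x y] by simp

lemma sublinear_directional_inf:
  assumes q: "sublinear q"
  shows "sublinear (directional_inf q x)"
proof (rule sublinearI)
  have "0 \<le> directional_inf q x 0"
    by (rule directional_inf_greatest) (simp add: sublinear_scaleR[OF q])
  then show "directional_inf q x 0 = 0"
    using directional_inf_le_self[OF q, of x 0] sublinear_0[OF q] by simp
next
  fix y z
  \<comment> \<open>Parameters \<open>s\<close> for \<open>y\<close> and \<open>t\<close> for
    \<open>z\<close> combine to \<open>s + t\<close> for \<open>y + z\<close>. The infimum is taken
    over \<open>t\<close> with \<open>s\<close> fixed, and then over \<open>s\<close>.\<close>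
  have "directional_inf q x (y + z) - (q (y + s *\<^sub>R x) - s * q x) \<le> directional_inf q x z"
    if s: "s \<ge> 0" for s
  proof (rule directional_inf_greatest)
    fix t :: real assume t: "t \<ge> 0"
    have "q ((y + z) + (s + t) *\<^sub>R x) \<le> q (y + s *\<^sub>R x) + q (z + t *\<^sub>R x)"
      using sublinear_add[OF q, of "y + s *\<^sub>R x" "z + t *\<^sub>R x"] by (simp add: algebra_simps)
    moreover have "directional_inf q x (y + z) \<le> q ((y + z) + (s + t) *\<^sub>R x) - (s + t) * q x"
      using s t by (intro directional_inf_le q) simp
    ultimately show "directional_inf q x (y + z) - (q (y + s *\<^sub>R x) - s * q x)
        \<le> q (z + t *\<^sub>R x) - t * q x"
      by (simp add: algebra_simps)
  qed
  then have "directional_inf q x (y + z) - directional_inf q x z \<le> directional_inf q x y"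
    by (intro directional_inf_greatest) (smt (verit))
  then show "directional_inf q x (y + z) \<le> directional_inf q x y + directional_inf q x z"
    by simp
next
  fix c :: real and y assume c: "c > 0"
  \<comment> \<open>The parameter \<open>t\<close> for \<open>y\<close> corresponds to
    \<open>c * t\<close> for \<open>c *\<^sub>R y\<close>.\<close>
  have "directional_inf q x (c *\<^sub>R y) / c \<le> directional_inf q x y"
  proof (rule directional_inf_greatest)
    fix t :: real assume t: "t \<ge> 0"
    have "directional_inf q x (c *\<^sub>R y) \<le> q (c *\<^sub>R y + (c * t) *\<^sub>R x) - (c * t) * q x"
      using c t by (intro directional_inf_le q) simp
    also have "\<dots> = c * (q (y + t *\<^sub>R x) - t * q x)"
      using sublinear_scaleR[OF q, of c "y + t *\<^sub>R x"] c by (simp add: algebra_simps)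
    finally show "directional_inf q x (c *\<^sub>R y) / c \<le> q (y + t *\<^sub>R x) - t * q x"
      using c by (simp add: field_simps)
  qed
  then show "directional_inf q x (c *\<^sub>R y) \<le> c * directional_inf q x y"
    using c by (simp add: field_simps)
qed

text \<open>Of two members \<open>q\<close> and \<open>r\<close> of the chain the smaller one,
  \<open>s\<close>, satisfies \<open>s (x + y) \<le> s x + s y \<le> q x + r y\<close>; hence the
  infima over \<open>q\<close> and \<open>r\<close> may be taken independently. The common bound
  \<open>p\<close> makes these infima finite.\<close>

lemma sublinear_chain_inf:
  assumes C: "\<And>q. q \<in> C \<Longrightarrow> sublinear q" "C \<noteq> {}"
    and chain: "\<And>q r. q \<in> C \<Longrightarrow> r \<in> C \<Longrightarrow> q \<le> r \<or> r \<le> q"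
    and le: "\<And>q x. q \<in> C \<Longrightarrow> q x \<le> p x"
  shows "sublinear (\<lambda>x. INF q\<in>C. q x)" and "q \<in> C \<Longrightarrow> (INF q\<in>C. q x) \<le> q x"
proof -
  have lower: "(INF q\<in>C. q x) \<le> q x" if "q \<in> C" for q x
  proof -
    have "- p (- x) \<le> r x" if "r \<in> C" for r
      using sublinear_minus[OF C(1)[OF that], of x] le[OF that, of "- x"] by simp
    then have "bdd_below ((\<lambda>r. r x) ` C)"
      by (intro bdd_belowI2) auto
    then show ?thesis using that by (rule cINF_lower)
  qed
  then show "q \<in> C \<Longrightarrow> (INF q\<in>C. q x) \<le> q x" .
  show "sublinear (\<lambda>x. INF q\<in>C. q x)"
  proof (rule sublinearI)
    have "(\<lambda>q. q 0) ` C = {0}" using C by (auto simp: sublinear_0 image_iff)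
    then show "(INF q\<in>C. q 0) = 0" by simp
  next
    fix x y
    have *: "(INF q\<in>C. q (x + y)) \<le> q x + r y" if qr: "q \<in> C" "r \<in> C" for q r
    proof -
      obtain s where s: "s \<in> C" "s \<le> q" "s \<le> r"
        using chain[OF qr] qr by blast
      have "(INF q\<in>C. q (x + y)) \<le> s (x + y)" by (rule lower[OF s(1)])
      also have "\<dots> \<le> s x + s y" by (rule sublinear_add[OF C(1)[OF s(1)]])
      also have "\<dots> \<le> q x + r y" using s by (intro add_mono) (auto simp: le_fun_def)
      finally show ?thesis .
    qed
    have "(INF q\<in>C. q (x + y)) - q x \<le> (INF q\<in>C. q y)" if "q \<in> C" for q
      using *[OF that] C(2) by (intro cINF_greatest) (auto simp: algebra_simps)
    then have "(INF q\<in>C. q (x + y)) - (INF q\<in>C. q y) \<le> (INF q\<in>C. q x)"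
      using C(2) by (intro cINF_greatest) (auto simp: algebra_simps)
    then show "(INF q\<in>C. q (x + y)) \<le> (INF q\<in>C. q x) + (INF q\<in>C. q y)" by simp
  next
    fix c :: real and x assume c: "c > 0"
    have "(INF q\<in>C. q (c *\<^sub>R x)) / c \<le> (INF q\<in>C. q x)"
      using C(2) lower[of _ "c *\<^sub>R x"] c sublinear_scaleR[OF C(1), of _ c x]
      by (intro cINF_greatest) (auto simp: field_simps)
    then show "(INF q\<in>C. q (c *\<^sub>R x)) \<le> c * (INF q\<in>C. q x)"
      using c by (simp add: field_simps)
  qed
qed

text \<open>
  A minimal sublinear functional \<open>q\<close> coincides with \<open>directional_inf q x\<close> for every \<open>x\<close>;
  taking \<open>t = 1\<close> in the infimum shows that \<open>q\<close> is superadditive.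
\<close>

lemma sublinear_linear_minorant:
  assumes p: "sublinear p"
  obtains g where "linear g" "\<And>x. g x \<le> p x"
proof -
  define A where "A = {q. sublinear q \<and> q \<le> p}"
  \<comment> \<open>Zorn's lemma is applied to the reversed order, so a maximal element is a minimal
    sublinear functional.\<close>
  have "\<exists>q\<in>A. \<forall>r\<in>A. q \<ge> r \<longrightarrow> r = q"
  proof (rule predicate_Zorn)
    show "partial_order_on A (relation_of (\<ge>) A)"
      by (rule partial_order_on_relation_ofI) auto
    fix C assume "C \<in> Chains (relation_of (\<ge>) A)"
    then have C: "\<And>q. q \<in> C \<Longrightarrow> q \<in> A" and chain: "\<And>q r. q \<in> C \<Longrightarrow> r \<in> C \<Longrightarrow> q \<le> r \<or> r \<le> q"
      by (auto simp: Chains_def relation_of_def)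
    show "\<exists>u\<in>A. \<forall>q\<in>C. q \<ge> u"
    \<comment> \<open>The infimum over the empty chain carries no information; there
      \<open>p\<close> itself serves as the bound.\<close>
    proof (cases "C = {}")
      case True
      with p show ?thesis by (auto simp: A_def)
    next
      case False
      define u where "u x = (INF q\<in>C. q x)" for x
      have C': "sublinear q" "q x \<le> p x" if "q \<in> C" for q x
        using C[OF that] by (auto simp: A_def le_fun_def)
      have u: "sublinear u" "\<And>q. q \<in> C \<Longrightarrow> u \<le> q"
        unfolding u_def le_fun_def using C' False chain
        by (blast intro!: sublinear_chain_inf[where p = p])+
      with False C have "u \<in> A" unfolding A_def by (blast intro: order_trans)
      with u show ?thesis by auto
    qed
  qed
  then obtain q where q: "sublinear q" "q \<le> p"
    and min: "\<And>r. sublinear r \<Longrightarrow> r \<le> q \<Longrightarrow> r = q"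
    unfolding A_def by (blast intro: order_trans)
  have eq: "directional_inf q x = q" for x
    using q by (intro min sublinear_directional_inf) (simp_all add: le_fun_def directional_inf_le_self)
  have add: "q (x + y) = q x + q y" for x y
    using directional_inf_le[OF q(1), of 1 y x] sublinear_add[OF q(1), of x y] by (simp add: eq)
  have minus: "q (- x) = - q x" for x
    using add[of x "- x"] sublinear_0[OF q(1)] by simp
  have "linear q"
  proof (rule linearI)
    fix c x
    show "q (c *\<^sub>R x) = c *\<^sub>R q x"
      \<comment> \<open>For negative \<open>c\<close>, homogeneity with factor \<open>- c\<close> is
        combined with oddness.\<close>
      using sublinear_scaleR[OF q(1), of c x] sublinear_scaleR[OF q(1), of "- c" x] minus[of "c *\<^sub>R x"]
      by (cases "c \<ge> 0") auto
  qed (rule add)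
  with q that show thesis by (auto simp: le_fun_def)
qed

text \<open>A linear minorant is taken of \<open>directional_inf norm x\<close> instead of
  \<open>norm\<close>: this forces \<open>g (- x) \<le> - norm x\<close>, hence equality at
  \<open>x\<close>, and replaces the extension of a functional from the line through
  \<open>x\<close>.\<close>

lemma norming_functional:
  fixes x :: "'x::real_normed_vector"
  obtains g where "linear g" "\<And>y. \<bar>g y\<bar> \<le> norm y" "g x = norm x"
proof -
  have n: "sublinear (norm :: 'x \<Rightarrow> real)"
    by (rule sublinearI) (auto intro: norm_triangle_ineq)
  obtain g where g: "linear g" "\<And>y. g y \<le> directional_inf norm x y"
    using sublinear_linear_minorant[OF sublinear_directional_inf[OF n]] by blast
  have le: "g y \<le> norm y" for y
    using g(2)[of y] directional_inf_le_self[OF n, of x y] by simp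
  have "g (- x) \<le> - norm x"
    using g(2)[of "- x"] directional_inf_le[OF n, of 1 x "- x"] by simp
  with le[of x] have "g x = norm x" by (simp add: linear_neg[OF g(1)])
  moreover have "\<bar>g y\<bar> \<le> norm y" for y
    using le[of y] le[of "- y"] by (simp add: linear_neg[OF g(1)])
  ultimately show thesis using g(1) that by blast
qed

section \<open>Norm preserving maps, quotients and completions\<close>

text \<open>The map may have a kernel, namely that of the seminorm. The notion therefore applies
  before the quotients are formed and passes through each stage of the construction.\<close>

definition norm_preserving :: "'v seminormed_space \<Rightarrow> ('v \<Rightarrow> 'x::real_normed_vector) \<Rightarrow> bool" where
  "norm_preserving V E \<longleftrightarrow>
     vecs V \<noteq> {} \<and>
     (\<forall>x\<in>vecs V. \<forall>y\<in>vecs V. vadd V x y \<in> vecs V \<and> E (vadd V x y) = E x + E y) \<and>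
     (\<forall>c. \<forall>x\<in>vecs V. vscale V c x \<in> vecs V \<and> E (vscale V c x) = c *\<^sub>R E x) \<and>
     (\<forall>x\<in>vecs V. vnorm V x = norm (E x))"

lemma norm_preservingD:
  assumes "norm_preserving V E"
  shows "vecs V \<noteq> {}"
    and "x \<in> vecs V \<Longrightarrow> y \<in> vecs V \<Longrightarrow> vadd V x y \<in> vecs V"
    and "x \<in> vecs V \<Longrightarrow> y \<in> vecs V \<Longrightarrow> E (vadd V x y) = E x + E y"
    and "x \<in> vecs V \<Longrightarrow> vscale V c x \<in> vecs V"
    and "x \<in> vecs V \<Longrightarrow> E (vscale V c x) = c *\<^sub>R E x"
    and "x \<in> vecs V \<Longrightarrow> vnorm V x = norm (E x)"
  using assms by (auto simp: norm_preserving_def)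

lemma norm_preserving_vdist:
  assumes "norm_preserving V E" "x \<in> vecs V" "y \<in> vecs V"
  shows "vdist V x y = dist (E x) (E y)"
  using assms by (simp add: vdist_def norm_preservingD[OF assms(1)] dist_norm)

lemma norm_preserving_subspace:
  assumes "norm_preserving V E"
  shows "subspace (E ` vecs V)"
proof (rule subspaceI)
  obtain x where x: "x \<in> vecs V" using norm_preservingD(1)[OF assms] by blast
  have "E (vscale V 0 x) = 0" by (simp add: norm_preservingD[OF assms] x)
  with norm_preservingD(4)[OF assms x] show "0 \<in> E ` vecs V" by (metis imageI)
next
  fix a b assume "a \<in> E ` vecs V" "b \<in> E ` vecs V"
  then show "a + b \<in> E ` vecs V"
    by (auto simp flip: norm_preservingD(3)[OF assms] intro: norm_preservingD(2)[OF assms])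
next
  fix c a assume "a \<in> E ` vecs V"
  then show "c *\<^sub>R a \<in> E ` vecs V"
    by (auto simp flip: norm_preservingD(5)[OF assms] intro: norm_preservingD(4)[OF assms])
qed

text \<open>Since \<open>vdist\<close> is the distance of the images, the classes of
  \<open>null_rel V\<close> are the fibres of \<open>E\<close>. So \<open>E\<close> is constant on
  each class and separates different ones.\<close>

lemma kernel_quotient_isometry:
  fixes E :: "'v \<Rightarrow> 'x::real_normed_vector"
  assumes E: "norm_preserving V E"
  obtains E' :: "'v set \<Rightarrow> 'x" where "norm_preserving (kernel_quotient V) E'" "inj_on E' (vecs (kernel_quotient V))"
proof -
  note D = norm_preservingD[OF E]
  define cl where "cl x = {y \<in> vecs V. E y = E x}" for x
  have cl: "null_rel V `` {x} = cl x" if "x \<in> vecs V" for x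
    using that by (auto simp: null_rel_def cl_def norm_preserving_vdist[OF E])
  have vecs: "vecs (kernel_quotient V) = cl ` vecs V"
    by (auto simp: kernel_quotient_def quotient_def cl)
  have cl_eq: "cl x = cl y" if "E x = E y" for x y
    using that by (simp add: cl_def)
  define E' where "E' A = the_elem (E ` A)" for A
  have self: "x \<in> cl x" if "x \<in> vecs V" for x
    using that by (simp add: cl_def)
  have E'_cl: "E' (cl x) = E x" if "x \<in> vecs V" for x
  proof -
    have "E ` cl x = {E x}" using self[OF that] by (auto simp: cl_def)
    then show ?thesis by (simp add: E'_def)
  qed
  have add: "vadd (kernel_quotient V) (cl x) (cl y) = cl (vadd V x y)"
    if "x \<in> vecs V" "y \<in> vecs V" for x y
  proof -
    \<comment> \<open>Addition on the quotient is a union over all representatives; each pair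
      contributes the same class, because the sums have the same image under
      \<open>E\<close>.\<close>
    have "null_rel V `` {vadd V a b} = cl (vadd V x y)" if "a \<in> cl x" "b \<in> cl y" for a b
    proof -
      have "a \<in> vecs V" "b \<in> vecs V" "E a = E x" "E b = E y" using that by (auto simp: cl_def)
      then show ?thesis
        using \<open>x \<in> vecs V\<close> \<open>y \<in> vecs V\<close> by (simp add: cl D cl_eq[of "vadd V a b" "vadd V x y"])
    qed
    moreover have "cl x \<noteq> {}" "cl y \<noteq> {}" using self that by blast+
    ultimately show ?thesis by (simp add: kernel_quotient_def)
  qed
  have scale: "vscale (kernel_quotient V) c (cl x) = cl (vscale V c x)" if "x \<in> vecs V" for c x
  proof -
    have "null_rel V `` {vscale V c a} = cl (vscale V c x)" if "a \<in> cl x" for a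
    proof -
      have "a \<in> vecs V" "E a = E x" using that by (auto simp: cl_def)
      then show ?thesis
        using \<open>x \<in> vecs V\<close> by (simp add: cl D cl_eq[of "vscale V c a" "vscale V c x"])
    qed
    with self that show ?thesis by (auto simp: kernel_quotient_def)
  qed
  have norm: "vnorm (kernel_quotient V) (cl x) = norm (E x)" if "x \<in> vecs V" for x
  proof -
    have "vnorm V ` cl x = {norm (E x)}"
      using self[OF that] that by (auto simp: cl_def D image_iff)
    then show ?thesis by (simp add: kernel_quotient_def)
  qed
  have "norm_preserving (kernel_quotient V) E'"
    using D by (auto simp: norm_preserving_def vecs add scale norm E'_cl)
  moreover have "inj_on E' (vecs (kernel_quotient V))"
    unfolding vecs by (intro inj_onI, elim imageE) (metis E'_cl cl_eq)
  ultimately show thesis by (rule that)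
qed

text \<open>Linearity and the norm identity pass to the limit. The kernel consists of the null
  sequences, which the next quotient removes.\<close>

lemma cauchy_space_isometry:
  fixes E :: "'v \<Rightarrow> 'x::banach"
  assumes E: "norm_preserving V E"
  shows "norm_preserving (cauchy_space V) (\<lambda>s. lim (\<lambda>n. E (s n)))"
proof -
  note D = norm_preservingD[OF E]
  \<comment> \<open>Completeness of the target enters here: a sequence is Cauchy for
    \<open>vdist\<close> exactly when its images converge.\<close>
  have vecs: "s \<in> vecs (cauchy_space V) \<longleftrightarrow> (\<forall>n. s n \<in> vecs V) \<and> convergent (\<lambda>n. E (s n))" for s
  proof (cases "\<forall>n. s n \<in> vecs V")
    case True
    then show ?thesis
      by (simp add: cauchy_space_def norm_preserving_vdist[OF E] Cauchy_def flip: Cauchy_convergent_iff)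
  qed (auto simp: cauchy_space_def)
  have lim: "(\<lambda>n. E (s n)) \<longlonglongrightarrow> lim (\<lambda>n. E (s n))" if "s \<in> vecs (cauchy_space V)" for s
    using that by (simp add: vecs convergent_LIMSEQ_iff)
  show ?thesis
    unfolding norm_preserving_def
  proof (intro conjI ballI allI)
    obtain x where "x \<in> vecs V" using D(1) by blast
    then have "(\<lambda>n. x) \<in> vecs (cauchy_space V)" by (simp add: vecs convergent_const)
    then show "vecs (cauchy_space V) \<noteq> {}" by blast
  next
    fix s t assume s: "s \<in> vecs (cauchy_space V)" and t: "t \<in> vecs (cauchy_space V)"
    have eq: "E (vadd (cauchy_space V) s t n) = E (s n) + E (t n)" for n
      using s t by (simp add: cauchy_space_def D)
    have "(\<lambda>n. E (vadd (cauchy_space V) s t n)) \<longlonglongrightarrow> lim (\<lambda>n. E (s n)) + lim (\<lambda>n. E (t n))"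
      unfolding eq by (intro tendsto_add lim s t)
    moreover have "vadd (cauchy_space V) s t n \<in> vecs V" for n
      using s t by (simp add: cauchy_space_def D)
    ultimately show "vadd (cauchy_space V) s t \<in> vecs (cauchy_space V)"
      "lim (\<lambda>n. E (vadd (cauchy_space V) s t n)) = lim (\<lambda>n. E (s n)) + lim (\<lambda>n. E (t n))"
      by (auto simp: vecs convergent_def limI)
  next
    fix c s assume s: "s \<in> vecs (cauchy_space V)"
    have eq: "E (vscale (cauchy_space V) c s n) = c *\<^sub>R E (s n)" for n
      using s by (simp add: cauchy_space_def D)
    have "(\<lambda>n. E (vscale (cauchy_space V) c s n)) \<longlonglongrightarrow> c *\<^sub>R lim (\<lambda>n. E (s n))"
      unfolding eq by (intro tendsto_scaleR tendsto_const lim s)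
    moreover have "vscale (cauchy_space V) c s n \<in> vecs V" for n
      using s by (simp add: cauchy_space_def D)
    ultimately show "vscale (cauchy_space V) c s \<in> vecs (cauchy_space V)"
      "lim (\<lambda>n. E (vscale (cauchy_space V) c s n)) = c *\<^sub>R lim (\<lambda>n. E (s n))"
      by (auto simp: vecs convergent_def limI)
  next
    fix s assume s: "s \<in> vecs (cauchy_space V)"
    then have "(\<lambda>n. vnorm V (s n)) = (\<lambda>n. norm (E (s n)))"
      by (simp add: vecs D)
    then show "vnorm (cauchy_space V) s = norm (lim (\<lambda>n. E (s n)))"
      using tendsto_norm[OF lim[OF s]] by (simp add: cauchy_space_def limI)
  qed
qed

text \<open>The map is carried through the kernel quotient, the Cauchy sequences and the quotient by
  null sequences; injectivity after the last stage makes it a bijection onto its range.\<close>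

lemma completion_linear_isometry:
  fixes E :: "'v \<Rightarrow> 'x::banach"
  assumes "norm_preserving V E"
  obtains S :: "'x set" and T where "subspace S" "linear_isometry_onto (completion (kernel_quotient V)) S T"
proof -
  obtain E1 :: "'v set \<Rightarrow> 'x" where "norm_preserving (kernel_quotient V) E1"
    using kernel_quotient_isometry[OF assms] by blast
  from kernel_quotient_isometry[OF cauchy_space_isometry[OF this]]
  obtain T :: "(nat \<Rightarrow> 'v set) set \<Rightarrow> 'x"
    where T: "norm_preserving (completion (kernel_quotient V)) T"
      "inj_on T (vecs (completion (kernel_quotient V)))"
    unfolding completion_def by blast
  have "linear_isometry_onto (completion (kernel_quotient V)) (T ` vecs (completion (kernel_quotient V))) T"
    using T(2) norm_preservingD[OF T(1)] by (auto simp: linear_isometry_onto_def bij_betw_def)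
  with norm_preserving_subspace[OF T(1)] that show thesis by blast
qed

section \<open>The functionals of an embedded metric space\<close>

text \<open>The linear extension of \<open>\<phi>\<close> from point masses to finitely supported
  functions; the weights may be negative.\<close>

definition barycenter :: "('a \<Rightarrow> 'x::real_vector) \<Rightarrow> ('a \<Rightarrow> real) \<Rightarrow> 'x" where
  "barycenter \<phi> f = (\<Sum>v | f v \<noteq> 0. f v *\<^sub>R \<phi> v)"

lemma barycenter_superset:
  assumes "finite A" "{v. f v \<noteq> 0} \<subseteq> A"
  shows "barycenter \<phi> f = (\<Sum>v\<in>A. f v *\<^sub>R \<phi> v)"
  unfolding barycenter_def using assms by (intro sum.mono_neutral_left) auto

lemma barycenter_add:
  assumes "finite {v. f v \<noteq> 0}" "finite {v. g v \<noteq> 0}"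
  shows "barycenter \<phi> (\<lambda>v. f v + g v) = barycenter \<phi> f + barycenter \<phi> g"
proof -
  \<comment> \<open>Cancellation may shrink the support of the sum, so all three sums are taken over
    the union.\<close>
  let ?A = "{v. f v \<noteq> 0} \<union> {v. g v \<noteq> 0}"
  have "finite ?A" using assms by simp
  moreover have "{v. f v + g v \<noteq> 0} \<subseteq> ?A" by auto
  ultimately show ?thesis
    by (simp add: barycenter_superset[of ?A] scaleR_add_left sum.distrib)
qed

lemma barycenter_scale: "barycenter \<phi> (\<lambda>v. c * f v) = c *\<^sub>R barycenter \<phi> f"
  by (cases "c = 0") (simp_all add: barycenter_def scaleR_sum_right)

text \<open>Total mass is the barycenter of the constant map 1, so closure of \<open>TP M\<close>
  under the operations follows from linearity of the barycenter.\<close>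

lemma TP_iff:
  "f \<in> TP M \<longleftrightarrow> finite {v. f v \<noteq> 0} \<and> {v. f v \<noteq> 0} \<subseteq> M \<and> barycenter (\<lambda>_. 1::real) f = 0"
  by (simp add: TP_def barycenter_def)

lemma TP_add: "f \<in> TP M \<Longrightarrow> g \<in> TP M \<Longrightarrow> (\<lambda>v. f v + g v) \<in> TP M"
  by (force simp: TP_iff barycenter_add
      intro: finite_subset[of _ "{v. f v \<noteq> 0} \<union> {v. g v \<noteq> 0}"])

lemma TP_scale: "f \<in> TP M \<Longrightarrow> (\<lambda>v. c * f v) \<in> TP M"
  by (auto simp: TP_iff barycenter_scale intro: finite_subset[of _ "{v. f v \<noteq> 0}"])

text \<open>\<open>restrict\<close> fixes the values outside \<open>M\<close>, so that these are
  functions on \<open>M\<close> in the extensional sense.\<close>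

definition dual_ball_functions :: "'a set \<Rightarrow> ('a \<Rightarrow> 'x::real_normed_vector) \<Rightarrow> ('a \<Rightarrow> real) set" where
  "dual_ball_functions M \<phi> =
     (\<lambda>g. restrict (\<lambda>u. g (\<phi> u)) M) ` {g. linear g \<and> (\<forall>x. \<bar>g x\<bar> \<le> norm x)}"

lemma pairing_restrict_linear:
  assumes "linear g" "f \<in> TP M"
  shows "pairing (restrict (\<lambda>u. g (\<phi> u)) M) f = g (barycenter \<phi> f)"
proof -
  have "(\<Sum>v | f v \<noteq> 0. restrict (\<lambda>u. g (\<phi> u)) M v * f v) = (\<Sum>v | f v \<noteq> 0. f v * g (\<phi> v))"
    using assms(2) by (intro sum.cong) (auto simp: TP_def)
  then show ?thesis
    by (simp add: pairing_def barycenter_def linear_sum[OF assms(1)] linear_scale[OF assms(1)])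
qed

text \<open>Every functional in the dual ball gives at most the norm, and one norming
  \<open>barycenter \<phi> f\<close> attains it: the supremum is a maximum.\<close>

lemma K_seminorm_dual_ball_functions:
  assumes "f \<in> TP M"
  shows "K_seminorm (dual_ball_functions M \<phi>) f = norm (barycenter \<phi> f)"
proof -
  obtain g where g: "linear g" "\<And>y. \<bar>g y\<bar> \<le> norm y" "g (barycenter \<phi> f) = norm (barycenter \<phi> f)"
    using norming_functional by blast
  show ?thesis
    unfolding K_seminorm_def
  proof (rule cSup_eq_maximum)
    have "\<bar>pairing (restrict (\<lambda>u. g (\<phi> u)) M) f\<bar> = norm (barycenter \<phi> f)"
      by (simp add: pairing_restrict_linear g assms)
    with g show "norm (barycenter \<phi> f) \<in> insert 0 ((\<lambda>l. \<bar>pairing l f\<bar>) ` dual_ball_functions M \<phi>)"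
      by (force simp: dual_ball_functions_def)
  qed (auto simp: dual_ball_functions_def pairing_restrict_linear assms)
qed

lemma dual_ball_functions_condition_A:
  assumes "\<And>u v. u \<in> M \<Longrightarrow> v \<in> M \<Longrightarrow> dist (\<phi> u) (\<phi> v) = d u v"
  shows "condition_A M d (dual_ball_functions M \<phi>)"
  by (auto simp: condition_A_def dual_ball_functions_def dist_norm
      simp flip: linear_diff assms[unfolded dist_norm])

text \<open>For each pair of points the witness comes from a functional norming
  \<open>\<phi> u - \<phi> v\<close>.\<close>

lemma dual_ball_functions_condition_B:
  assumes "\<And>u v. u \<in> M \<Longrightarrow> v \<in> M \<Longrightarrow> dist (\<phi> u) (\<phi> v) = d u v"
  shows "condition_B M d (dual_ball_functions M \<phi>)"
  unfolding condition_B_def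
proof (intro ballI)
  fix u v assume uv: "u \<in> M" "v \<in> M"
  obtain g where g: "linear g" "\<And>y. \<bar>g y\<bar> \<le> norm y" "g (\<phi> u - \<phi> v) = norm (\<phi> u - \<phi> v)"
    using norming_functional by blast
  have "\<bar>restrict (\<lambda>u. g (\<phi> u)) M u - restrict (\<lambda>u. g (\<phi> u)) M v\<bar> = d u v"
    using uv g(3) by (simp add: linear_diff[OF g(1)] flip: assms) (simp add: dist_norm)
  with g show "\<exists>l\<in>dual_ball_functions M \<phi>. \<bar>l u - l v\<bar> = d u v"
    by (force simp: dual_ball_functions_def)
qed

lemma norm_preserving_barycenter:
  "norm_preserving (TP_seminormed M (dual_ball_functions M \<phi>)) (barycenter \<phi>)"
proof -
  have "(\<lambda>_. 0) \<in> TP M" by (simp add: TP_def)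
  then have "TP M \<noteq> {}" by blast
  moreover have "finite {v. f v \<noteq> 0}" if "f \<in> TP M" for f
    using that by (simp add: TP_def)
  ultimately show ?thesis
    by (simp add: norm_preserving_def TP_seminormed_def TP_add TP_scale barycenter_add
        barycenter_scale K_seminorm_dual_ball_functions)
qed

theorem proposition1p9:
  fixes M :: "'a set" and d :: "'a \<Rightarrow> 'a \<Rightarrow> real"
  assumes "Metric_space M d"
    and "\<exists>\<phi> :: 'a \<Rightarrow> 'x::banach. \<forall>u\<in>M. \<forall>v\<in>M. dist (\<phi> u) (\<phi> v) = d u v"
  shows "\<exists>K. K \<subseteq> M \<rightarrow>\<^sub>E (UNIV :: real set) \<and>
           condition_A M d K \<and> condition_B M d K \<and>
           (\<exists>(S :: 'x set) T. subspace S \<and> linear_isometry_onto (TP_completion M K) S T)"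
proof -
  obtain \<phi> :: "'a \<Rightarrow> 'x" where \<phi>: "\<And>u v. u \<in> M \<Longrightarrow> v \<in> M \<Longrightarrow> dist (\<phi> u) (\<phi> v) = d u v"
    using assms(2) by blast
  let ?K = "dual_ball_functions M \<phi>"
  obtain S :: "'x set" and T where "subspace S" "linear_isometry_onto (TP_completion M ?K) S T"
    using completion_linear_isometry[OF norm_preserving_barycenter] unfolding TP_completion_def
    by blast
  moreover have "?K \<subseteq> M \<rightarrow>\<^sub>E UNIV"
    by (auto simp: dual_ball_functions_def)
  ultimately show ?thesis
    by (intro exI[of _ ?K] conjI exI[of _ S] exI[of _ T])
      (auto intro!: dual_ball_functions_condition_A dual_ball_functions_condition_B \<phi>)
qed

end
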